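(* Let $T>0$ and let $f:[0,T]\to\mathbb{R}$ be a regulated non-constant function with $p$-variation index $\upsilon(f)$. Suppose that the metric entropy index $\Delta(\mathrm{gr}(f))$ of the graph $\mathrm{gr}(f)$ of $f$ is defined and $$\Delta(\mathrm{gr}(f))=2-\frac{1}{1\vee\upsilon(f)}.$$ Then for every strictly increasing sequence $\eta=\{N_m\colon m\ge 1\}$ of positive integers, $f$ has the oscillation $\eta$-summing index $\delta_\eta(f)$, and $$\delta_\eta(f)=\frac{1}{1\vee\upsilon(f)}.$$
   Context: Regulated: $f:[0,T]\to\mathbb{R}$ is regulated if the limits $f(t+)=\lim_{u\downarrow t}f(u)$ for each $t\in[0,T)$ and $f(t-)=\lim_{u\uparrow t}f(u)$ for each $t\in(0,T]$ exist (in $\mathbb{R}$). $p$-variation: for $0<p<\infty$, $v_p(f)=v_p(f;[0,T])=\sup\sum_{i=1}^n|f(t_i)-f(t_{i-1})|^p$, the supremum over all partitions $0=t_0<t_1<\cdots<t_n=T$. The $p$-variation index is $\upsilon(f)=\upsilon(f;[0,T])=\inf\{p>0\colon v_p(f;[0,T])<\infty\}\in[0,+\infty]$, with $\inf\emptyset=+\infty$. Here $a\vee b=\max\{a,b\}$ and $1/(+\infty)=0$. Graph: $\mathrm{gr}(f)=\{(t,f(t))\colon t\in[0,T]\}\subset\mathbb{R}^2$. Metric entropy index: for a nonempty bounded $E\subset\mathbb{R}^2$ and $\epsilon>0$, $N(E;\epsilon)$ is the minimum number of closed balls of diameter $\epsilon$ required to cover $E$. Let $\Delta^-(E)=\liminf_{\epsilon\downarrow0}\frac{\log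 N(E;\epsilon)}{\log(1/\epsilon)}$ and $\Delta^+(E)=\limsup_{\epsilon\downarrow0}\frac{\log N(E;\epsilon)}{\log(1/\epsilon)}$. If $\Delta^-(E)=\Delta^+(E)$, the metric entropy index $\Delta(E)$ is defined, as this common value. Oscillation $\eta$-summing index: for $A\subset[0,T]$ let $\mathrm{Osc}(f;A)=\sup\{|f(t)-f(s)|\colon s,t\in A\}$. For $\eta=\{N_m\}$ let $\lambda(m)=\{iT/N_m\colon i=0,\dots,N_m\}$, $\Delta_{i,m}=[(i-1)T/N_m,iT/N_m]$ and $Q(f;\lambda(m))=\sum_{i=1}^{N_m}\mathrm{Osc}(f;\Delta_{i,m})$. Let $\delta_\eta^-(f)$ and $\delta_\eta^+(f)$ be respectively the $\liminf$ and the $\limsup$ as $m\to\infty$ of $\frac{\log\left(Q(f;\lambda(m))/N_m\right)}{\log(1/N_m)}$. If $\delta_\eta^-(f)=\delta_\eta^+(f)$, one says that $f$ has the oscillation $\eta$-summing index $\delta_\eta(f):=\delta_\eta^-(f)=\delta_\eta^+(f)$. *)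

theory Defs
  imports "HOL-Analysis.Analysis"
begin

text \<open>
  A function on $[0,T]$ is represented by a total function on the reals; every notion below
  depends only on its values on \<open>{0..T}\<close>.
\<close>

definition regulated :: "real \<Rightarrow> (real \<Rightarrow> real) \<Rightarrow> bool" where
  "regulated T f \<longleftrightarrow>
     (\<forall>t\<in>{0..<T}. \<exists>l. (f \<longlongrightarrow> l) (at_right t)) \<and>
     (\<forall>t\<in>{0<..T}. \<exists>l. (f \<longlongrightarrow> l) (at_left t))"

definition partitions :: "real \<Rightarrow> (nat \<times> (nat \<Rightarrow> real)) set" where
  "partitions T = {(n, t). t 0 = 0 \<and> t n = T \<and> (\<forall>i<n. t i < t (Suc i))}"

definition p_variation :: "real \<Rightarrow> real \<Rightarrow> (real \<Rightarrow> real) \<Rightarrow> ereal" where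
  "p_variation p T f =
     (SUP (n, t)\<in>partitions T. ereal (\<Sum>i<n. \<bar>f (t (Suc i)) - f (t i)\<bar> powr p))"

text \<open>The infimum is taken in the extended reals, where the infimum of the empty set is \<open>\<infinity>\<close>.\<close>

definition p_variation_index :: "real \<Rightarrow> (real \<Rightarrow> real) \<Rightarrow> ereal" where
  "p_variation_index T f = Inf {ereal p | p. p > 0 \<and> p_variation p T f < \<infinity>}"

definition gr :: "real \<Rightarrow> (real \<Rightarrow> real) \<Rightarrow> (real \<times> real) set" where
  "gr T f = {(t, f t) | t. t \<in> {0..T}}"

text \<open>
  The distance on \<open>real \<times> real\<close> is Euclidean, and a closed ball of diameter \<open>\<epsilon>\<close> has radius
  \<open>\<epsilon> / 2\<close>.
\<close>

definition covering_number :: "(real \<times> real) set \<Rightarrow> real \<Rightarrow> nat" where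
  "covering_number E \<epsilon> =
     (LEAST n. \<exists>C. finite C \<and> card C = n \<and> E \<subseteq> (\<Union>c\<in>C. cball c (\<epsilon> / 2)))"

definition lower_metric_entropy_index :: "(real \<times> real) set \<Rightarrow> ereal" where
  "lower_metric_entropy_index E =
     Liminf (at_right 0) (\<lambda>\<epsilon>. ereal (ln (real (covering_number E \<epsilon>)) / ln (1 / \<epsilon>)))"

definition upper_metric_entropy_index :: "(real \<times> real) set \<Rightarrow> ereal" where
  "upper_metric_entropy_index E =
     Limsup (at_right 0) (\<lambda>\<epsilon>. ereal (ln (real (covering_number E \<epsilon>)) / ln (1 / \<epsilon>)))"

definition metric_entropy_index_defined :: "(real \<times> real) set \<Rightarrow> bool" where
  "metric_entropy_index_defined E \<longleftrightarrow>
     lower_metric_entropy_index E = upper_metric_entropy_index E"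

text \<open>Meaningful only under \<^const>\<open>metric_entropy_index_defined\<close>.\<close>

definition metric_entropy_index :: "(real \<times> real) set \<Rightarrow> ereal" where
  "metric_entropy_index E = lower_metric_entropy_index E"

text \<open>
  The supremum is a real one, so this is the oscillation only when \<open>f\<close> is bounded on the nonempty
  set \<open>A\<close>; regulated functions are bounded on $[0,T]$.
\<close>

definition Osc :: "(real \<Rightarrow> real) \<Rightarrow> real set \<Rightarrow> real" where
  "Osc f A = Sup {\<bar>f t - f s\<bar> | s t. s \<in> A \<and> t \<in> A}"

definition osc_sum :: "real \<Rightarrow> (real \<Rightarrow> real) \<Rightarrow> nat \<Rightarrow> real" where
  "osc_sum T f N = (\<Sum>i=1..N. Osc f {(real i - 1) * T / real N .. real i * T / real N})"

text \<open>
  A sequence $\{N_m : m \ge 1\}$ is a function \<open>\<eta>\<close> on the naturals; the value at \<open>0\<close>, and a possible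
  first value $1$, where the denominator below vanishes, do not affect the limits.
\<close>

definition lower_osc_summing_index :: "real \<Rightarrow> (real \<Rightarrow> real) \<Rightarrow> (nat \<Rightarrow> nat) \<Rightarrow> ereal" where
  "lower_osc_summing_index T f \<eta> =
     liminf (\<lambda>m. ereal (ln (osc_sum T f (\<eta> m) / real (\<eta> m)) / ln (1 / real (\<eta> m))))"

definition upper_osc_summing_index :: "real \<Rightarrow> (real \<Rightarrow> real) \<Rightarrow> (nat \<Rightarrow> nat) \<Rightarrow> ereal" where
  "upper_osc_summing_index T f \<eta> =
     limsup (\<lambda>m. ereal (ln (osc_sum T f (\<eta> m) / real (\<eta> m)) / ln (1 / real (\<eta> m))))"

definition has_osc_summing_index :: "real \<Rightarrow> (real \<Rightarrow> real) \<Rightarrow> (nat \<Rightarrow> nat) \<Rightarrow> bool" where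
  "has_osc_summing_index T f \<eta> \<longleftrightarrow>
     lower_osc_summing_index T f \<eta> = upper_osc_summing_index T f \<eta>"

text \<open>Meaningful only under \<^const>\<open>has_osc_summing_index\<close>.\<close>

definition osc_summing_index :: "real \<Rightarrow> (real \<Rightarrow> real) \<Rightarrow> (nat \<Rightarrow> nat) \<Rightarrow> ereal" where
  "osc_summing_index T f \<eta> = lower_osc_summing_index T f \<eta>"

end

theory Submission
  imports Defs
begin

text \<open>
  Write \<open>Q N\<close> for the oscillation sum of \<open>f\<close> over the partition of \<open>[0,T]\<close> into \<open>N\<close> equal cells and
  \<open>\<alpha> = 1 / max 1 \<upsilon>(f)\<close>. The exponent \<open>ln (Q N / N) / ln (1 / N)\<close> converges to \<open>\<alpha>\<close> along all integers,
  hence along every sequence that tends to infinity, because \<open>Q N\<close> is squeezed from both sides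
  up to factors \<open>N powr o(1)\<close>.

  Variation bounds \<open>Q N\<close> from above. Choosing in each cell two points that nearly realise the
  oscillation gives the nodes of a partition, so for \<open>v\<^sub>p(f) < \<infinity>\<close> the \<open>p\<close>-th powers of the cell
  oscillations have a sum bounded independently of \<open>N\<close>
  (\<open>osc_powr_sum_bounded\<close>). For \<open>p \<ge> 1\<close>, comparing the cell oscillations with
  \<open>N powr (-1/p)\<close>, which does the work of Hoelder's inequality, yields
  \<open>Q N \<le> C * N powr (1 - 1/p)\<close> (\<open>osc_sum_le_powr\<close>), and letting \<open>p\<close> decrease to \<open>max 1 \<upsilon>(f)\<close> shows that the lower limit of the
  exponent is at least \<open>\<alpha>\<close>.

  Entropy bounds \<open>Q N\<close> from below. Over a cell of width \<open>h = T/N\<close> with oscillation \<open>\<omega>\<close>, the graph is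
  covered by about \<open>\<omega>/h + 1\<close> squares of side \<open>h\<close>, so \<open>N + N * Q N\<close> is, up to a constant, at least the
  covering number at scale \<open>1/N\<close> (\<open>covering_number_gr_le\<close>). Since \<open>f\<close> is not constant, \<open>Q N\<close> is bounded
  away from \<open>0\<close> (\<open>increment_le_osc_sum\<close>), and the summand \<open>N\<close> can be absorbed: \<open>N * Q N\<close> dominates
  the covering number, which is \<open>N powr (2 - \<alpha> + o(1))\<close> by the hypothesis on the entropy index. Thus
  \<open>Q N / N \<ge> N powr (- \<alpha> - o(1))\<close>, and the upper limit of the exponent is at most \<open>\<alpha>\<close>.
\<close>

section \<open>Oscillation of a bounded function\<close>

text \<open>
  One-sided limits bound \<open>f\<close> on both sides of every point, and the value at the point itself adds
  only a constant. So \<open>f\<close> is locally bounded, and compactness of the interval, in the form of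
  Bolzano's bisection principle, makes the bound global.
\<close>
lemma regulated_imp_bounded:
  assumes "T \<ge> 0" and "regulated T f"
  shows "bounded (f ` {0..T})"
proof -
  let ?P = "\<lambda>a b. bounded (f ` ({a..b} \<inter> {0..T}))"
  have right: "\<exists>d>0. \<exists>B. \<forall>y. x < y \<and> y < x + d \<and> y \<in> {0..T} \<longrightarrow> \<bar>f y\<bar> \<le> B" for x
  proof (cases "x \<in> {0..<T}")
    case True
    then obtain l where l: "(f \<longlongrightarrow> l) (at_right x)"
      using assms(2) unfolding regulated_def by blast
    have "\<forall>\<^sub>F y in at_right x. dist (f y) l < 1"
      using tendstoD[OF l] by simp
    then obtain b where "b > x" and b: "\<forall>y>x. y < b \<longrightarrow> dist (f y) l < 1"
      unfolding eventually_at_right_field by blast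
    then show ?thesis
      by (intro exI[of _ "b - x"]) (fastforce simp: dist_real_def intro!: exI[of _ "\<bar>l\<bar> + 1"])
  next
    case False
    show ?thesis
    proof (cases "x < 0")
      case True
      then show ?thesis by (intro exI[of _ "-x"]) auto
    qed (use False in \<open>auto intro!: exI[of _ 1]\<close>)
  qed
  have left: "\<exists>d>0. \<exists>B. \<forall>y. x - d < y \<and> y < x \<and> y \<in> {0..T} \<longrightarrow> \<bar>f y\<bar> \<le> B" for x
  proof (cases "x \<in> {0<..T}")
    case True
    then obtain l where l: "(f \<longlongrightarrow> l) (at_left x)"
      using assms(2) unfolding regulated_def by blast
    have "\<forall>\<^sub>F y in at_left x. dist (f y) l < 1"
      using tendstoD[OF l] by simp
    then obtain b where "b < x" and b: "\<forall>y>b. y < x \<longrightarrow> dist (f y) l < 1"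
      unfolding eventually_at_left_field by blast
    then show ?thesis
      by (intro exI[of _ "x - b"]) (fastforce simp: dist_real_def intro!: exI[of _ "\<bar>l\<bar> + 1"])
  next
    case False
    show ?thesis
    proof (cases "x > T")
      case True
      then show ?thesis by (intro exI[of _ "x - T"]) auto
    qed (use False in \<open>auto intro!: exI[of _ 1]\<close>)
  qed
  \<comment> \<open>Small intervals around the endpoints stick out of \<^term>\<open>{0..T}\<close>, where nothing is known about \<open>f\<close>;
    hence the intersection in \<open>?P\<close>.\<close>
  have "?P 0 T"
  proof (rule Bolzano[OF assms(1), of ?P])
    fix a b c :: real
    assume "?P a b" "?P b c" "a \<le> b" "b \<le> c"
    then have "bounded (f ` ({a..b} \<inter> {0..T}) \<union> f ` ({b..c} \<inter> {0..T}))" by simp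
    moreover have "{a..c} \<subseteq> {a..b} \<union> {b..c}"
      by auto
    ultimately show "?P a c"
      by (elim bounded_subset) blast
  next
    fix x :: real
    obtain d1 B1 where 1: "d1 > 0" "\<And>y. x < y \<Longrightarrow> y < x + d1 \<Longrightarrow> y \<in> {0..T} \<Longrightarrow> \<bar>f y\<bar> \<le> B1"
      using right[of x] by blast
    obtain d2 B2 where 2: "d2 > 0" "\<And>y. x - d2 < y \<Longrightarrow> y < x \<Longrightarrow> y \<in> {0..T} \<Longrightarrow> \<bar>f y\<bar> \<le> B2"
      using left[of x] by blast
    have "?P a b" if "a \<le> x" "x \<le> b" "b - a < min d1 d2" for a b
    proof (rule boundedI[of _ "max (max B1 B2) \<bar>f x\<bar>"])
      fix z assume "z \<in> f ` ({a..b} \<inter> {0..T})"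
      then obtain y where y: "y \<in> {a..b}" "y \<in> {0..T}" "z = f y" by blast
      consider "y < x" | "y = x" | "x < y" by linarith
      then show "norm z \<le> max (max B1 B2) \<bar>f x\<bar>"
        by cases (use 1(2)[of y] 2(2)[of y] y that in auto)
    qed
    then show "\<exists>d>0. \<forall>a b. a \<le> x \<and> x \<le> b \<and> b - a < d \<longrightarrow> ?P a b"
      using 1(1) 2(1) by (intro exI[of _ "min d1 d2"]) auto
  qed
  then show ?thesis by simp
qed

lemma bdd_above_differences:
  fixes f :: "real \<Rightarrow> real"
  assumes "bounded (f ` A)"
  shows "bdd_above {\<bar>f t - f s\<bar> | s t. s \<in> A \<and> t \<in> A}"
proof -
  obtain B where B: "\<And>x. x \<in> A \<Longrightarrow> \<bar>f x\<bar> \<le> B"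
    using assms by (auto simp: bounded_iff)
  have "\<bar>f t - f s\<bar> \<le> 2 * B" if "s \<in> A" "t \<in> A" for s t
    using B[OF that(1)] B[OF that(2)] by linarith
  then show ?thesis
    by (intro bdd_aboveI[of _ "2 * B"]) auto
qed

lemma abs_diff_le_Osc:
  assumes "bounded (f ` A)" "s \<in> A" "t \<in> A"
  shows "\<bar>f t - f s\<bar> \<le> Osc f A"
  unfolding Osc_def by (rule cSup_upper[OF _ bdd_above_differences[OF assms(1)]]) (use assms in auto)

lemma Osc_leI:
  assumes "A \<noteq> {}" "\<And>s t. s \<in> A \<Longrightarrow> t \<in> A \<Longrightarrow> \<bar>f t - f s\<bar> \<le> K"
  shows "Osc f A \<le> K"
  unfolding Osc_def
proof (rule cSup_least)
  show "{\<bar>f t - f s\<bar> | s t. s \<in> A \<and> t \<in> A} \<noteq> {}"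
    using assms(1) by blast
qed (use assms(2) in auto)

lemma Osc_mono:
  assumes "bounded (f ` B)" "A \<subseteq> B" "A \<noteq> {}"
  shows "Osc f A \<le> Osc f B"
  using assms by (intro Osc_leI abs_diff_le_Osc) auto

lemma Osc_nonneg:
  assumes "bounded (f ` A)" "A \<noteq> {}"
  shows "Osc f A \<ge> 0"
  using abs_diff_le_Osc[OF assms(1)] assms(2) by fastforce

text \<open>
  The supremum need not be attained. A loss of the factor \<open>2\<close> only changes constants, and unlike an
  additive error it also covers the case of zero oscillation.
\<close>
lemma Osc_half_attained:
  assumes "bounded (f ` A)" "A \<noteq> {}"
  obtains s t where "s \<in> A" "t \<in> A" "s \<le> t" "Osc f A \<le> 2 * \<bar>f t - f s\<bar>"
proof -
  have "\<exists>s\<in>A. \<exists>t\<in>A. Osc f A \<le> 2 * \<bar>f t - f s\<bar>"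
  proof (rule ccontr)
    assume neg: "\<not> ?thesis"
    have "Osc f A \<le> Osc f A / 2"
      by (rule Osc_leI[OF assms(2)]) (use neg in force)
    then show False
      using neg assms(2) by fastforce
  qed
  then obtain s t where "s \<in> A" "t \<in> A" "Osc f A \<le> 2 * \<bar>f t - f s\<bar>" by blast
  then show thesis
    using that[of s t] that[of t s] by (cases "s \<le> t") (auto simp: abs_minus_commute)
qed

section \<open>The uniform grid\<close>

definition grid_cell :: "real \<Rightarrow> nat \<Rightarrow> nat \<Rightarrow> real set" where
  "grid_cell T N i = {(real i - 1) * T / real N .. real i * T / real N}"

lemma osc_sum_grid_cell: "osc_sum T f N = (\<Sum>i=1..N. Osc f (grid_cell T N i))"
  by (simp add: osc_sum_def grid_cell_def)

lemma grid_cell_nonempty: "T \<ge> 0 \<Longrightarrow> grid_cell T N i \<noteq> {}"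
  by (auto simp: grid_cell_def intro!: divide_right_mono mult_right_mono)

lemma grid_cell_subset:
  assumes "T \<ge> 0" "i \<in> {1..N}"
  shows "grid_cell T N i \<subseteq> {0..T}"
proof -
  have "real i * T / real N \<le> T"
    using assms by (auto simp: divide_le_eq mult.commute intro!: mult_left_mono)
  moreover have "0 \<le> (real i - 1) * T / real N"
    using assms by simp
  ultimately show ?thesis
    unfolding grid_cell_def by simp
qed

lemma bounded_on_grid_cell:
  assumes "T \<ge> 0" "bounded (f ` {0..T})" "i \<in> {1..N}"
  shows "bounded (f ` grid_cell T N i)"
  using bounded_subset[OF assms(2)] grid_cell_subset[OF assms(1,3)] by blast

lemma grid_cells_cover:
  assumes "T > 0" "N > 0" "x \<in> {0..T}"
  obtains i where "i \<in> {1..N}" "x \<in> grid_cell T N i"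
proof (cases "x = 0")
  case True
  then show ?thesis
    using that[of 1] assms by (simp add: grid_cell_def)
next
  case False
  define i where "i = nat \<lceil>x * real N / T\<rceil>"
  have pos: "0 < x * real N / T"
    using assms False by simp
  then have i: "real i = of_int \<lceil>x * real N / T\<rceil>"
    unfolding i_def by simp
  have "x * real N / T \<le> real N"
    using assms by (simp add: divide_le_eq)
  then have "i \<le> N" "i \<ge> 1"
    using pos unfolding i_def by linarith+
  moreover have "x * real N / T \<le> real i" "real i - 1 \<le> x * real N / T"
    using ceiling_correct[of "x * real N / T"] i by linarith+
  then have "x \<in> grid_cell T N i"
    using assms by (auto simp: grid_cell_def field_simps)
  ultimately show ?thesis
    using that by simp
qed

text \<open>
  The increment telescopes over the cells to the left of \<open>x\<close>. For a non-constant function this keeps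
  the oscillation sums away from zero, uniformly in \<open>N\<close>.
\<close>
lemma increment_le_osc_sum:
  assumes "T > 0" "N > 0" "bounded (f ` {0..T})" "x \<in> {0..T}"
  shows "\<bar>f x - f 0\<bar> \<le> osc_sum T f N"
proof -
  let ?O = "\<lambda>i. Osc f (grid_cell T N i)"
  have diff: "\<bar>f t - f s\<bar> \<le> ?O i" if "i \<in> {1..N}" "s \<in> grid_cell T N i" "t \<in> grid_cell T N i" for i s t
    using abs_diff_le_Osc[OF bounded_on_grid_cell[OF _ assms(3) that(1)] that(2,3)] assms(1) by simp
  have nonneg: "?O i \<ge> 0" if "i \<in> {1..N}" for i
    using Osc_nonneg[OF bounded_on_grid_cell[OF _ assms(3) that] grid_cell_nonempty] assms(1) by simp
  have ends: "(real i - 1) * T / N \<in> grid_cell T N i" "real i * T / N \<in> grid_cell T N i" for i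
    using assms by (auto simp: grid_cell_def divide_right_mono)
  have node: "\<bar>f (real k * T / N) - f 0\<bar> \<le> (\<Sum>i=1..k. ?O i)" if "k \<le> N" for k
    using that
  proof (induction k)
    case (Suc k)
    have "\<bar>f (real (Suc k) * T / N) - f (real k * T / N)\<bar> \<le> ?O (Suc k)"
      using diff[of "Suc k", OF _ ends] Suc.prems by simp
    moreover have "(\<Sum>i=1..Suc k. ?O i) = (\<Sum>i=1..k. ?O i) + ?O (Suc k)"
      by simp
    ultimately show ?case
      using Suc by linarith
  qed simp
  obtain j where j: "j \<in> {1..N}" "x \<in> grid_cell T N j"
    using grid_cells_cover assms by blast
  obtain k where k: "j = Suc k"
    using j(1) by (cases j) auto
  have "\<bar>f x - f (real k * T / N)\<bar> \<le> ?O j"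
    using diff[OF j(1) ends(1) j(2)] k by simp
  then have "\<bar>f x - f 0\<bar> \<le> (\<Sum>i=1..j. ?O i)"
    using node[of k] j k by simp
  also have "\<dots> \<le> osc_sum T f N"
    unfolding osc_sum_grid_cell using j nonneg by (intro sum_mono2) auto
  finally show ?thesis .
qed

section \<open>Upper bounds for the oscillation sums from the variation\<close>

text \<open>
  Points chosen cell by cell may coincide, whereas the nodes of a partition strictly increase.
  Asking only for some partition whose variation sum is at least \<open>S\<close> lets the nodes be appended one at
  a time, with a repeated node simply skipped.
\<close>
definition partition_sum_at_least :: "real \<Rightarrow> (real \<Rightarrow> real) \<Rightarrow> real \<Rightarrow> real \<Rightarrow> bool" where
  "partition_sum_at_least p f b S \<longleftrightarrow> (\<exists>n t. (n, t) \<in> partitions b \<and> S \<le> (\<Sum>i<n. \<bar>f (t (Suc i)) - f (t i)\<bar> powr p))"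

lemma partition_sum_at_least_extend:
  assumes "partition_sum_at_least p f b S" "b \<le> c"
  shows "partition_sum_at_least p f c (S + \<bar>f c - f b\<bar> powr p)"
proof (cases "b = c")
  case False
  obtain n t where nt: "(n, t) \<in> partitions b" "S \<le> (\<Sum>i<n. \<bar>f (t (Suc i)) - f (t i)\<bar> powr p)"
    using assms(1) unfolding partition_sum_at_least_def by blast
  define u where "u = t(Suc n := c)"
  have "(Suc n, u) \<in> partitions c"
    using nt(1) assms(2) False by (auto simp: partitions_def u_def less_Suc_eq)
  moreover have "(\<Sum>i<Suc n. \<bar>f (u (Suc i)) - f (u i)\<bar> powr p) =
      (\<Sum>i<n. \<bar>f (t (Suc i)) - f (t i)\<bar> powr p) + \<bar>f c - f b\<bar> powr p"
    using nt(1) by (simp add: u_def partitions_def)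
  ultimately show ?thesis
    using nt(2) unfolding partition_sum_at_least_def by (intro exI[of _ "Suc n"] exI[of _ u]) simp
qed (use assms in simp)

lemma partition_sum_at_least_extend_mono:
  assumes "partition_sum_at_least p f b S" "b \<le> c"
  shows "partition_sum_at_least p f c S"
proof -
  have "S \<le> S + \<bar>f c - f b\<bar> powr p" by simp
  then show ?thesis
    using partition_sum_at_least_extend[OF assms] unfolding partition_sum_at_least_def by (meson order_trans)
qed

text \<open>
  The points \<open>s 1 \<le> t 1 \<le> s 2 \<le> t 2 \<le> \<dots>\<close> are ordered because the cells are, so all of them can serve
  as nodes of a single partition. The induction walks through the points \<open>s i\<close>, \<open>t i\<close> and the
  right endpoint of each cell, and discards the increments other than those from \<open>s i\<close> to \<open>t i\<close>.
\<close>
lemma grid_increments_le_p_variation: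
  assumes "T > 0" "N > 0"
    and st: "\<And>i. i \<in> {1..N} \<Longrightarrow> s i \<in> grid_cell T N i \<and> t i \<in> grid_cell T N i \<and> s i \<le> t i"
  shows "ereal (\<Sum>i=1..N. \<bar>f (t i) - f (s i)\<bar> powr p) \<le> p_variation p T f"
proof -
  have "partition_sum_at_least p f (real k * T / N) (\<Sum>i=1..k. \<bar>f (t i) - f (s i)\<bar> powr p)" if "k \<le> N" for k
    using that
  proof (induction k)
    case 0
    then show ?case
      by (auto simp: partition_sum_at_least_def partitions_def intro!: exI[of _ 0] exI[of _ "\<lambda>_. 0"])
  next
    case (Suc k)
    have mem: "s (Suc k) \<in> grid_cell T N (Suc k)" "t (Suc k) \<in> grid_cell T N (Suc k)"
      "s (Suc k) \<le> t (Suc k)"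
      using st[of "Suc k"] Suc.prems by auto
    have "partition_sum_at_least p f (s (Suc k)) (\<Sum>i=1..k. \<bar>f (t i) - f (s i)\<bar> powr p)"
      by (rule partition_sum_at_least_extend_mono[OF Suc.IH]) (use Suc.prems mem in \<open>auto simp: grid_cell_def\<close>)
    then have "partition_sum_at_least p f (t (Suc k)) (\<Sum>i=1..Suc k. \<bar>f (t i) - f (s i)\<bar> powr p)"
      using partition_sum_at_least_extend[of p f "s (Suc k)" _ "t (Suc k)"] mem(3) by simp
    then show ?case
      by (rule partition_sum_at_least_extend_mono) (use mem in \<open>simp add: grid_cell_def\<close>)
  qed
  from this[of N] have "partition_sum_at_least p f T (\<Sum>i=1..N. \<bar>f (t i) - f (s i)\<bar> powr p)"
    using assms(2) by simp
  then obtain n u where nu: "(n, u) \<in> partitions T"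
    "(\<Sum>i=1..N. \<bar>f (t i) - f (s i)\<bar> powr p) \<le> (\<Sum>i<n. \<bar>f (u (Suc i)) - f (u i)\<bar> powr p)"
    unfolding partition_sum_at_least_def by blast
  from nu(2) have "ereal (\<Sum>i=1..N. \<bar>f (t i) - f (s i)\<bar> powr p)
      \<le> ereal (\<Sum>i<n. \<bar>f (u (Suc i)) - f (u i)\<bar> powr p)" by simp
  also have "\<dots> \<le> p_variation p T f"
    unfolding p_variation_def by (rule SUP_upper2[OF nu(1)]) simp
  finally show ?thesis .
qed

lemma osc_powr_sum_bounded:
  assumes "T > 0" "bounded (f ` {0..T})" "p > 0" "p_variation p T f < \<infinity>"
  obtains K where "K \<ge> 0" "\<And>N. N > 0 \<Longrightarrow> (\<Sum>i=1..N. Osc f (grid_cell T N i) powr p) \<le> K"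
proof -
  obtain V where V: "p_variation p T f \<le> ereal V"
    using assms(4) by (cases "p_variation p T f") auto
  have bound: "(\<Sum>i=1..N. Osc f (grid_cell T N i) powr p) \<le> 2 powr p * V" if "N > 0" for N
  proof -
    have "\<exists>s t. s \<in> grid_cell T N i \<and> t \<in> grid_cell T N i \<and> s \<le> t \<and>
        Osc f (grid_cell T N i) \<le> 2 * \<bar>f t - f s\<bar>" if "i \<in> {1..N}" for i
      using Osc_half_attained[OF bounded_on_grid_cell[OF _ assms(2) that] grid_cell_nonempty] assms(1)
      by (metis less_imp_le)
    then obtain s t where st: "\<And>i. i \<in> {1..N} \<Longrightarrow> s i \<in> grid_cell T N i \<and> t i \<in> grid_cell T N i \<and>
        s i \<le> t i \<and> Osc f (grid_cell T N i) \<le> 2 * \<bar>f (t i) - f (s i)\<bar>"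
      by metis
    have "(\<Sum>i=1..N. Osc f (grid_cell T N i) powr p) \<le> (\<Sum>i=1..N. (2 * \<bar>f (t i) - f (s i)\<bar>) powr p)"
      using st assms Osc_nonneg[OF bounded_on_grid_cell grid_cell_nonempty]
      by (intro sum_mono powr_mono2) auto
    also have "\<dots> = 2 powr p * (\<Sum>i=1..N. \<bar>f (t i) - f (s i)\<bar> powr p)"
      by (simp add: powr_mult sum_distrib_left)
    also have "\<dots> \<le> 2 powr p * V"
    proof (intro mult_left_mono)
      have "ereal (\<Sum>i=1..N. \<bar>f (t i) - f (s i)\<bar> powr p) \<le> p_variation p T f"
        using st by (intro grid_increments_le_p_variation[OF assms(1) \<open>N > 0\<close>]) auto
      from order_trans[OF this V] show "(\<Sum>i=1..N. \<bar>f (t i) - f (s i)\<bar> powr p) \<le> V"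
        by simp
    qed simp
    finally show ?thesis .
  qed
  have "0 \<le> (\<Sum>i=1..1. Osc f (grid_cell T 1 i) powr p)"
    by simp
  also have "\<dots> \<le> 2 powr p * V"
    by (rule bound) simp
  finally show thesis
    using that bound by blast
qed

text \<open>
  In place of Hoelder's inequality, each oscillation \<open>\<omega>\<close> is compared with a threshold \<open>d\<close>: either
  \<open>\<omega> \<le> d\<close>, or \<open>\<omega> = \<omega> powr (1 - p) * \<omega> powr p \<le> d powr (1 - p) * \<omega> powr p\<close>. Summing gives
  \<open>N * d + L * d powr (1 - p)\<close>, and both terms have the order \<open>N powr (1 - 1/p)\<close> for
  \<open>d = N powr (-1/p)\<close>. Finiteness is assumed for an exponent \<open>q \<le> p\<close>, possibly below \<open>1\<close>, as this is
  what the infimum in the variation index provides; boundedness of \<open>f\<close> turns \<open>q\<close> into \<open>p\<close>.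
\<close>
lemma osc_sum_le_powr:
  assumes "T > 0" "bounded (f ` {0..T})" "q > 0" "p_variation q T f < \<infinity>" "q \<le> p" "p \<ge> 1"
  obtains C where "C > 0" "\<And>N. N > 0 \<Longrightarrow> osc_sum T f N \<le> C * real N powr (1 - 1 / p)"
proof -
  let ?O = "\<lambda>N i. Osc f (grid_cell T N i)"
  obtain K where K: "K \<ge> 0" "\<And>N. N > 0 \<Longrightarrow> (\<Sum>i=1..N. ?O N i powr q) \<le> K"
    using osc_powr_sum_bounded[OF assms(1-4)] by blast
  define D where "D = Osc f {0..T}"
  have D: "?O N i \<le> D" if "i \<in> {1..N}" for N i
    unfolding D_def using assms(1)
    by (intro Osc_mono[OF assms(2)] grid_cell_subset that grid_cell_nonempty) auto
  define L where "L = D powr (p - q) * K"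
  have bound: "osc_sum T f N \<le> (1 + L) * real N powr (1 - 1 / p)" if "N > 0" for N
  proof -
    define d where "d = real N powr (- 1 / p)"
    have "d > 0"
      using that by (simp add: d_def)
    have N_d: "real N * d = real N powr (1 - 1 / p)"
      using that powr_add[of "real N" 1 "-1 / p"] by (simp add: d_def)
    have d_powr: "d powr (1 - p) = real N powr (1 - 1 / p)"
      using assms(6) unfolding d_def powr_powr by (intro arg_cong2[where f="(powr)"]) (auto simp: field_simps)
    have split: "?O N i \<le> d + d powr (1 - p) * (D powr (p - q) * ?O N i powr q)" if i: "i \<in> {1..N}" for i
    proof (cases "?O N i \<le> d")
      case True
      moreover have "0 \<le> d powr (1 - p) * (D powr (p - q) * ?O N i powr q)" by simp
      ultimately show ?thesis by linarith
    next
      case False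
      then have pos: "?O N i > 0"
        using \<open>d > 0\<close> by linarith
      have "?O N i = ?O N i powr (1 - p) * (?O N i powr (p - q) * ?O N i powr q)"
        using pos by (simp flip: powr_add)
      also have "\<dots> \<le> d powr (1 - p) * (D powr (p - q) * ?O N i powr q)"
        using False \<open>d > 0\<close> pos D[OF i] assms
        by (intro mult_mono powr_mono2 powr_mono2') auto
      finally show ?thesis
        using \<open>d > 0\<close> by linarith
    qed
    have "osc_sum T f N \<le> (\<Sum>i=1..N. d + d powr (1 - p) * (D powr (p - q) * ?O N i powr q))"
      unfolding osc_sum_grid_cell by (intro sum_mono split)
    also have "\<dots> = real N * d + d powr (1 - p) * (D powr (p - q) * (\<Sum>i=1..N. ?O N i powr q))"
      by (simp add: sum.distrib sum_distrib_left)
    also have "\<dots> \<le> real N * d + d powr (1 - p) * L"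
      unfolding L_def using K(2)[OF that] by (intro add_left_mono mult_left_mono) auto
    also have "\<dots> = (1 + L) * real N powr (1 - 1 / p)"
      unfolding N_d d_powr by (simp add: algebra_simps)
    finally show ?thesis .
  qed
  have "L \<ge> 0"
    unfolding L_def using K(1) by simp
  then show thesis
    using that[of "1 + L"] bound by simp
qed

text \<open>
  Every \<open>b\<close> strictly between \<open>a\<close> and \<open>1 / max 1 \<upsilon>(f)\<close> that is positive corresponds to the exponent
  \<open>p = 1/b > \<upsilon>(f)\<close>. For an infinite index \<open>a\<close> is negative, and boundedness of \<open>f\<close> suffices with
  \<open>b = 0\<close>.
\<close>
lemma osc_sum_le_powr_below_variation_index:
  assumes "T > 0" "bounded (f ` {0..T})" "ereal a < 1 / max 1 (p_variation_index T f)"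
  obtains b C where "a < b" "C > 0" "\<And>N. N > 0 \<Longrightarrow> osc_sum T f N \<le> C * real N powr (1 - b)"
proof (cases "p_variation_index T f = \<infinity>")
  case True
  then have "a < 0"
    using assms(3) by (simp add: max_def)
  define D where "D = Osc f {0..T}"
  have "D \<ge> 0"
    unfolding D_def using assms by (intro Osc_nonneg) auto
  have "osc_sum T f N \<le> (D + 1) * real N powr (1 - 0)" if "N > 0" for N
  proof -
    have "osc_sum T f N \<le> (\<Sum>i=1..N. D)"
      unfolding osc_sum_grid_cell D_def
      using assms(1)
      by (intro sum_mono Osc_mono[OF assms(2)] grid_cell_subset grid_cell_nonempty) auto
    then show ?thesis
      using that by (simp add: algebra_simps)
  qed
  then show ?thesis
    using that[of 0 "D + 1"] \<open>a < 0\<close> \<open>D \<ge> 0\<close> by simp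
next
  case False
  have "max 1 (p_variation_index T f) \<noteq> \<infinity>" "max 1 (p_variation_index T f) \<ge> 1"
    using False by (auto simp: max_def)
  then obtain m where m: "max 1 (p_variation_index T f) = ereal m" "m \<ge> 1"
    by (cases "max 1 (p_variation_index T f)") auto
  have "a < 1 / m"
    using assms(3) m by (simp add: one_ereal_def)
  then obtain b where b: "max a 0 < b" "b < 1 / m"
    using dense[of "max a 0" "1 / m"] m(2) by auto
  have "m < 1 / b"
    using b m(2) by (simp add: field_simps)
  then have "p_variation_index T f < ereal (1 / b)"
    using m(1) by (metis ereal_less(2) less_ereal.simps(1) max.strict_boundedE max_less_iff_conj)
  then obtain q where q: "q > 0" "p_variation q T f < \<infinity>" "q < 1 / b"
    unfolding p_variation_index_def Inf_less_iff by auto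
  have "1 / b \<ge> 1" "1 / (1 / b) = b" "a < b"
    using \<open>m < 1 / b\<close> m(2) b(1) by (linarith, simp_all)
  then show ?thesis
    using osc_sum_le_powr[OF assms(1,2) q(1,2), of "1 / b"] q(3) that[of b] by (metis less_imp_le)
qed

section \<open>Lower bounds for the oscillation sums from the covering number\<close>

text \<open>
  Above a cell of width \<open>h\<close> the graph lies in the column of height \<open>2 * \<omega>\<close> centred at the value of \<open>f\<close> at
  the left endpoint. That column is tiled by squares of side \<open>h\<close>, and a ball of radius \<open>h\<close>,
  that is of diameter \<open>2 * T / N\<close>, contains the square with the same centre. The lower bound \<open>1\<close>
  allows logarithms to be taken.
\<close>
lemma covering_number_gr_le:
  assumes "T > 0" "bounded (f ` {0..T})" "N > 0"
  shows "real (covering_number (gr T f) (2 * T / N)) \<le> 2 * real N * (1 + osc_sum T f N / T)"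
    and "covering_number (gr T f) (2 * T / N) \<ge> 1"
proof -
  let ?O = "\<lambda>i. Osc f (grid_cell T N i)"
  define h where "h = T / N"
  have "h > 0"
    using assms by (simp add: h_def)
  have nonneg: "?O i \<ge> 0" if "i \<in> {1..N}" for i
    using Osc_nonneg[OF bounded_on_grid_cell[OF _ assms(2) that] grid_cell_nonempty] assms(1) by simp
  \<comment> \<open>The largest index of a square, counted from the middle of the column over the \<open>i\<close>-th cell.\<close>
  define k where "k i = \<lfloor>?O i / h + 1 / 2\<rfloor>" for i
  define c where "c i j = ((real i - 1) * h + h / 2, f ((real i - 1) * h) + of_int j * h)" for i j
  define C where "C = (\<Union>i\<in>{1..N}. c i ` {- k i..k i})"
  have "finite C"
    by (simp add: C_def)
  have cover: "gr T f \<subseteq> (\<Union>z\<in>C. cball z (2 * T / N / 2))"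
  proof
    fix z assume "z \<in> gr T f"
    then obtain x where x: "x \<in> {0..T}" "z = (x, f x)"
      by (auto simp: gr_def)
    obtain i where i: "i \<in> {1..N}" "x \<in> grid_cell T N i"
      using grid_cells_cover[OF assms(1,3) x(1)] by blast
    have cell: "grid_cell T N i = {(real i - 1) * h..(real i - 1) * h + h}"
      by (simp add: grid_cell_def h_def algebra_simps diff_divide_distrib)
    define y where "y = (f x - f ((real i - 1) * h)) / h"
    define j where "j = round y"
    have "\<bar>f x - f ((real i - 1) * h)\<bar> \<le> ?O i"
      using i assms \<open>h > 0\<close>
      by (intro abs_diff_le_Osc bounded_on_grid_cell) (auto simp: cell)
    then have y: "\<bar>y\<bar> \<le> ?O i / h"
      using \<open>h > 0\<close> by (simp add: y_def divide_right_mono)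
    have jy: "\<bar>of_int j - y\<bar> \<le> 1 / 2"
      unfolding j_def by (rule of_int_round_abs_le)
    then have "j \<in> {- k i..k i}"
      using y abs_le_D1[OF jy] abs_le_D2[OF jy] abs_le_D1[OF y] abs_le_D2[OF y]
      unfolding k_def by (simp add: le_floor_iff minus_le_iff[of "\<lfloor>_\<rfloor>"])
    then have "c i j \<in> C"
      using i(1) unfolding C_def by blast
    have "y * h = f x - f ((real i - 1) * h)"
      using \<open>h > 0\<close> by (simp add: y_def)
    then have "snd (c i j) - f x = (of_int j - y) * h"
      by (simp add: c_def algebra_simps)
    then have "\<bar>snd (c i j) - f x\<bar> \<le> h / 2"
      using jy \<open>h > 0\<close> mult_right_mono[OF jy, of h] by (simp add: abs_mult)
    moreover have "\<bar>fst (c i j) - x\<bar> \<le> h / 2"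
      using i(2) unfolding cell c_def fst_conv atLeastAtMost_iff abs_le_iff by linarith
    moreover have "dist (c i j) z \<le> \<bar>fst (c i j) - x\<bar> + \<bar>snd (c i j) - f x\<bar>"
      using sqrt_sum_squares_le_sum_abs by (simp add: x(2) dist_prod_def dist_real_def)
    ultimately have "z \<in> cball (c i j) (2 * T / N / 2)"
      by (simp add: h_def)
    then show "z \<in> (\<Union>z\<in>C. cball z (2 * T / N / 2))"
      using \<open>c i j \<in> C\<close> by blast
  qed
  have "covering_number (gr T f) (2 * T / N) \<le> card C"
    unfolding covering_number_def by (rule Least_le) (use \<open>finite C\<close> cover in blast)
  moreover have "card C \<le> (\<Sum>i=1..N. card (c i ` {- k i..k i}))"
    unfolding C_def by (rule card_UN_le) simp
  moreover have "\<dots> \<le> (\<Sum>i=1..N. card {- k i..k i})"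
    by (intro sum_mono card_image_le) simp
  ultimately have "covering_number (gr T f) (2 * T / N) \<le> (\<Sum>i=1..N. card {- k i..k i})"
    by linarith
  then have "real (covering_number (gr T f) (2 * T / N)) \<le> (\<Sum>i=1..N. real (card {- k i..k i}))"
    unfolding of_nat_sum[symmetric] by (rule of_nat_mono)
  also have "\<dots> \<le> (\<Sum>i=1..N. 2 + 2 * (?O i / h))"
  proof (rule sum_mono)
    fix i assume "i \<in> {1..N}"
    then have "?O i / h \<ge> 0"
      using nonneg \<open>h > 0\<close> by simp
    then have "k i \<ge> 0" "of_int (k i) \<le> ?O i / h + 1 / 2"
      by (auto simp: k_def)
    then show "real (card {- k i..k i}) \<le> 2 + 2 * (?O i / h)"
      by simp
  qed
  also have "\<dots> = 2 * real N + 2 * (osc_sum T f N / h)"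
    by (simp add: osc_sum_grid_cell sum.distrib sum_distrib_left sum_divide_distrib)
  also have "\<dots> = 2 * real N * (1 + osc_sum T f N / T)"
    using assms(1,3) by (simp add: h_def field_simps)
  finally show "real (covering_number (gr T f) (2 * T / N)) \<le> 2 * real N * (1 + osc_sum T f N / T)" .
  have "\<exists>D. finite D \<and> card D = covering_number (gr T f) (2 * T / N) \<and>
      gr T f \<subseteq> (\<Union>z\<in>D. cball z (2 * T / N / 2))"
    unfolding covering_number_def by (rule LeastI_ex) (use \<open>finite C\<close> cover in blast)
  then obtain D where D: "finite D" "card D = covering_number (gr T f) (2 * T / N)"
    "gr T f \<subseteq> (\<Union>z\<in>D. cball z (2 * T / N / 2))"
    by blast
  have "(0, f 0) \<in> gr T f"
    using assms(1) by (auto simp: gr_def)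
  then have "D \<noteq> {}"
    using D(3) by blast
  then show "covering_number (gr T f) (2 * T / N) \<ge> 1"
    using D(1,2) by (metis One_nat_def Suc_leI card_gt_0_iff)
qed

section \<open>The limit of the oscillation exponents\<close>

text \<open>
  Since \<open>ln (1 / N)\<close> is negative, the upper bound \<open>Q N \<le> C * N powr (1 - b)\<close> turns into a lower bound
  \<open>b - ln C / ln N\<close> for the exponent. The positive lower bound \<open>c\<close> makes the logarithm of
  \<open>Q N\<close> monotone.
\<close>
lemma osc_exponent_eventually_gt:
  assumes "T > 0" "bounded (f ` {0..T})" "ereal a < 1 / max 1 (p_variation_index T f)"
    and "c > 0" "\<And>N. N > 0 \<Longrightarrow> c \<le> osc_sum T f N"
  shows "\<forall>\<^sub>F N in sequentially. a < ln (osc_sum T f N / N) / ln (1 / N)"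
proof -
  obtain b C where b: "a < b" "C > 0" "\<And>N. N > 0 \<Longrightarrow> osc_sum T f N \<le> C * real N powr (1 - b)"
    using osc_sum_le_powr_below_variation_index[OF assms(1-3)] by blast
  have "(\<lambda>N. b - ln C / ln (real N)) \<longlonglongrightarrow> b - 0"
    by (intro tendsto_diff tendsto_const real_tendsto_divide_at_top[OF tendsto_const]
        filterlim_compose[OF ln_at_top filterlim_real_sequentially])
  then have "\<forall>\<^sub>F N in sequentially. a < b - ln C / ln (real N)"
    using b(1) by (auto dest: order_tendstoD)
  then show ?thesis
    using eventually_gt_at_top[of 1]
  proof eventually_elim
    case (elim N)
    have "ln (osc_sum T f N) \<le> ln (C * real N powr (1 - b))"
      using b(3)[of N] assms(4) assms(5)[of N] elim by (intro ln_mono) auto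
    also have "\<dots> = ln C + (1 - b) * ln N"
      using b(2) elim by (simp add: ln_mult ln_powr)
    finally have "ln (osc_sum T f N / N) \<le> ln C - b * ln N"
      using assms(4) assms(5)[of N] elim by (simp add: ln_div algebra_simps)
    then have "ln (osc_sum T f N / N) / ln N \<le> (ln C - b * ln N) / ln N"
      using elim by (intro divide_right_mono) auto
    then have "b - ln C / ln N \<le> - (ln (osc_sum T f N / N) / ln N)"
      using elim by (simp add: diff_divide_distrib)
    also have "\<dots> = ln (osc_sum T f N / N) / ln (1 / N)"
      using elim by (simp add: ln_div[of 1])
    finally show ?case
      using elim by linarith
  qed
qed

text \<open>
  The entropy hypothesis is read at the scales \<open>\<epsilon> = 2 * T / N\<close>, where \<open>ln (1 / \<epsilon>)\<close> is asymptotic to \<open>ln N\<close>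
  and the covering number is at most \<open>K * N * Q N = K * N\<^sup>2 * (Q N / N)\<close>. The square is the source of the
  \<open>2\<close> in the relation between the two indices.
\<close>
lemma osc_exponent_eventually_lt:
  assumes "T > 0" "bounded (f ` {0..T})"
    and "c > 0" "\<And>N. N > 0 \<Longrightarrow> c \<le> osc_sum T f N"
    and lim: "((\<lambda>\<epsilon>. ln (covering_number (gr T f) \<epsilon>) / ln (1 / \<epsilon>)) \<longlongrightarrow> 2 - \<alpha>) (at_right 0)"
    and "\<alpha> < b"
  shows "\<forall>\<^sub>F N in sequentially. ln (osc_sum T f N / N) / ln (1 / N) < b"
proof -
  \<comment> \<open>From \<open>1 \<le> Q N / c\<close>, the bound \<open>2 * N * (1 + Q N / T)\<close> is at most \<open>K * N * Q N\<close>.\<close>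
  define K where "K = 2 * (1 / c + 1 / T)"
  have "K > 0"
    using assms by (simp add: K_def add_pos_pos)
  define v where "v N = ln (covering_number (gr T f) (2 * T / N)) / ln (N / (2 * T))" for N :: nat
  have ln_top: "filterlim (\<lambda>N. ln (real N)) at_top sequentially"
    by (rule filterlim_compose[OF ln_at_top filterlim_real_sequentially])
  have "(\<lambda>N. 2 * T / real N) \<longlonglongrightarrow> 0"
    by (rule real_tendsto_divide_at_top[OF tendsto_const filterlim_real_sequentially])
  moreover have "\<forall>\<^sub>F N in sequentially. 2 * T / real N > 0"
    using eventually_gt_at_top[of 0] by eventually_elim (use assms(1) in simp)
  ultimately have "filterlim (\<lambda>N. 2 * T / real N) (at_right 0) sequentially"
    by (rule tendsto_imp_filterlim_at_right)
  from filterlim_compose[OF lim this] have v: "v \<longlonglongrightarrow> 2 - \<alpha>"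
    unfolding v_def by simp
  \<comment> \<open>Beyond \<open>M\<close> the scale \<open>2 * T / N\<close> is below \<open>1\<close>, so the denominator in \<open>v\<close> is positive.\<close>
  obtain M :: nat where "2 * T < real M"
    using reals_Archimedean2 by blast
  have "(\<lambda>N. 2 + ln K / ln (real N) - v N * (1 - ln (2 * T) / ln (real N)))
      \<longlonglongrightarrow> 2 + 0 - (2 - \<alpha>) * (1 - 0)"
    by (intro tendsto_add tendsto_diff tendsto_mult v tendsto_const
        real_tendsto_divide_at_top[OF tendsto_const ln_top])
  then have "\<forall>\<^sub>F N in sequentially. 2 + ln K / ln (real N) - v N * (1 - ln (2 * T) / ln (real N)) < b"
    using \<open>\<alpha> < b\<close> by (auto dest: order_tendstoD)
  then show ?thesis
    using eventually_gt_at_top[of 1] eventually_ge_at_top[of M]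
  proof eventually_elim
    case (elim N)
    let ?Q = "osc_sum T f N"
    have Q: "c \<le> ?Q" "?Q > 0"
      using assms(3) assms(4)[of N] elim by auto
    have "real (covering_number (gr T f) (2 * T / N)) \<le> 2 * N * (1 + ?Q / T)"
      using covering_number_gr_le(1)[OF assms(1,2), of N] elim by simp
    also have "\<dots> \<le> 2 * N * (?Q / c + ?Q / T)"
      using Q assms(3) by (intro mult_left_mono add_right_mono) auto
    also have "\<dots> = K * N * ?Q"
      by (simp add: K_def algebra_simps add_divide_distrib)
    finally have "ln (covering_number (gr T f) (2 * T / N)) \<le> ln (K * N * ?Q)"
      using covering_number_gr_le(2)[OF assms(1,2), of N] elim by (intro ln_mono) auto
    also have "\<dots> = ln K + ln N + ln ?Q"
      using \<open>K > 0\<close> Q elim by (simp add: ln_mult)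
    finally have upper: "ln (covering_number (gr T f) (2 * T / N)) \<le> ln K + 2 * ln N + ln (?Q / N)"
      using Q elim by (simp add: ln_div)
    have "ln (N / (2 * T)) = ln N - ln (2 * T)"
      using assms(1) elim by (simp add: ln_div)
    moreover have "ln (N / (2 * T)) > 0"
      using assms(1) elim \<open>2 * T < real M\<close> by (intro ln_gt_zero) (simp add: less_divide_eq)
    ultimately have "ln (covering_number (gr T f) (2 * T / N)) = v N * (ln N - ln (2 * T))"
      by (simp add: v_def)
    with upper have "v N * (ln N - ln (2 * T)) / ln N \<le> (ln K + 2 * ln N + ln (?Q / N)) / ln N"
      using elim by (intro divide_right_mono) auto
    then have "- (ln (?Q / N) / ln N) \<le> 2 + ln K / ln N - v N * (1 - ln (2 * T) / ln N)"
      using elim by (simp add: add_divide_distrib diff_divide_distrib right_diff_distrib)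
    moreover have "ln (?Q / N) / ln (1 / N) = - (ln (?Q / N) / ln N)"
      using elim by (simp add: ln_div[of 1])
    ultimately show ?case
      using elim by linarith
  qed
qed

theorem theorem4:
  fixes T :: real and f :: "real \<Rightarrow> real"
  assumes "T > 0"
    and "regulated T f"
    and "\<not> f constant_on {0..T}"
    and "metric_entropy_index_defined (gr T f)"
    and "metric_entropy_index (gr T f) = 2 - 1 / max 1 (p_variation_index T f)"
  shows "\<forall>\<eta> :: nat \<Rightarrow> nat. strict_mono_on {1..} \<eta> \<and> (\<forall>m\<ge>1. \<eta> m > 0) \<longrightarrow>
           has_osc_summing_index T f \<eta> \<and>
           osc_summing_index T f \<eta> = 1 / max 1 (p_variation_index T f)"
proof (intro allI impI)
  fix \<eta> :: "nat \<Rightarrow> nat"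
  assume \<eta>: "strict_mono_on {1..} \<eta> \<and> (\<forall>m\<ge>1. \<eta> m > 0)"
  have bdd: "bounded (f ` {0..T})"
    using assms(1,2) by (intro regulated_imp_bounded) auto
  obtain x where x: "x \<in> {0..T}" "f x \<noteq> f 0"
    using assms(3) unfolding constant_on_def by blast
  define c where "c = \<bar>f x - f 0\<bar>"
  have c: "c > 0" "\<And>N. N > 0 \<Longrightarrow> c \<le> osc_sum T f N"
    using x increment_le_osc_sum[OF assms(1) _ bdd x(1)] by (auto simp: c_def)
  obtain \<alpha> where \<alpha>: "1 / max 1 (p_variation_index T f) = ereal \<alpha>"
  proof (cases "max 1 (p_variation_index T f)")
    case (real m)
    then have "m \<ge> 1"
      by (metis ereal_less_eq(3) max.cobounded1 one_ereal_def)
    then show ?thesis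
      using that[of "1 / m"] real by (simp add: one_ereal_def)
  next
    case PInf
    then show ?thesis
      using that[of 0] by (simp add: zero_ereal_def)
  next
    case MInf
    then show ?thesis
      by (metis max.cobounded1 MInfty_neq_ereal(1) ereal_infty_less_eq(2) one_ereal_def)
  qed
  have two: "2 - ereal \<alpha> = ereal (2 - \<alpha>)"
    by (metis ereal_minus(1) numeral_eq_ereal)
  have "((\<lambda>\<epsilon>. ereal (ln (covering_number (gr T f) \<epsilon>) / ln (1 / \<epsilon>))) \<longlongrightarrow> ereal (2 - \<alpha>)) (at_right 0)"
    using assms(4,5) unfolding \<alpha> two metric_entropy_index_defined_def metric_entropy_index_def
      lower_metric_entropy_index_def upper_metric_entropy_index_def
    by (intro Liminf_eq_Limsup) auto
  then have lim: "((\<lambda>\<epsilon>. ln (covering_number (gr T f) \<epsilon>) / ln (1 / \<epsilon>)) \<longlongrightarrow> 2 - \<alpha>) (at_right 0)"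
    by simp
  have "(\<lambda>N. ln (osc_sum T f N / N) / ln (1 / N)) \<longlonglongrightarrow> \<alpha>"
  proof (rule order_tendstoI)
    fix a assume "a < \<alpha>"
    then show "\<forall>\<^sub>F N in sequentially. a < ln (osc_sum T f N / N) / ln (1 / N)"
      using \<alpha> by (intro osc_exponent_eventually_gt[OF assms(1) bdd _ c]) auto
  next
    fix b assume "\<alpha> < b"
    then show "\<forall>\<^sub>F N in sequentially. ln (osc_sum T f N / N) / ln (1 / N) < b"
      by (intro osc_exponent_eventually_lt[OF assms(1) bdd c lim]) auto
  qed
  moreover have "filterlim \<eta> at_top sequentially"
  proof -
    \<comment> \<open>The sequence starts at index \<open>1\<close>; its value at \<open>0\<close> is arbitrary.\<close>
    have "strict_mono (\<lambda>m. \<eta> (Suc m))"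
      using \<eta> by (auto simp: strict_mono_def strict_mono_on_def)
    then show ?thesis
      using filterlim_subseq filterlim_sequentially_Suc by blast
  qed
  ultimately have "(\<lambda>m. ln (osc_sum T f (\<eta> m) / \<eta> m) / ln (1 / \<eta> m)) \<longlonglongrightarrow> \<alpha>"
    by (rule filterlim_compose)
  then have "(\<lambda>m. ereal (ln (osc_sum T f (\<eta> m) / \<eta> m) / ln (1 / \<eta> m))) \<longlonglongrightarrow> ereal \<alpha>"
    by simp
  from lim_imp_Liminf[OF trivial_limit_sequentially this] lim_imp_Limsup[OF trivial_limit_sequentially this]
  show "has_osc_summing_index T f \<eta> \<and>
      osc_summing_index T f \<eta> = 1 / max 1 (p_variation_index T f)"
    unfolding \<alpha> has_osc_summing_index_def osc_summing_index_def
      lower_osc_summing_index_def upper_osc_summing_index_def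
    by simp
qed

end
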